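(* The sectional curvature of the Fisher-Rao metric $g^F$ on the space of beta distributions is given, for all $\alpha,\beta>0$, by $$K(\alpha,\beta)=\frac{\psi''(\alpha)\psi''(\beta)\psi''(\alpha+\beta)}{4\,d(\alpha,\beta)^2}\left(\frac{\psi'(\alpha)}{\psi''(\alpha)}+\frac{\psi'(\beta)}{\psi''(\beta)}-\frac{\psi'(\alpha+\beta)}{\psi''(\alpha+\beta)}\right),$$ where $d(\alpha,\beta)=\psi'(\alpha)\psi'(\beta)-\psi'(\alpha+\beta)(\psi'(\alpha)+\psi'(\beta))$.
   Context: $\psi(x)=\frac{d}{dx}\ln\Gamma(x)$ is the digamma function and $\psi',\psi''$ are its first and second derivatives. The Fisher-Rao metric on the parameter space $(0,\infty)\times(0,\infty)$ of the beta distributions $B(\alpha,\beta)$ (density $\frac{\Gamma(\alpha+\beta)}{\Gamma(\alpha)\Gamma(\beta)}x^{\alpha-1}(1-x)^{\beta-1}$ on $[0,1]$) is the Riemannian metric with matrix, in the coordinates $(\alpha,\beta)$, $$g^F(\alpha,\beta)=\begin{pmatrix}\psi'(\alpha)-\psi'(\alpha+\beta) & -\psi'(\alpha+\beta)\\ -\psi'(\alpha+\beta) & \psi'(\beta)-\psi'(\alpha+\beta)\end{pmatrix}.$$ Since this manifold is two-dimensional, its sectional curvature at a point $(\alpha,\beta)$ is a single number, denoted $K(\alpha,\beta)$ (the Gaussian curvature). *)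

theory Defs
  imports "HOL-Analysis.Analysis"
begin

text \<open>
  A Riemannian metric on an open subset of \<open>\<real>\<^sup>n\<close> is represented by its coordinate matrix
  \<open>g p = (g\<^sub>i\<^sub>j(p))\<close>; tangent vectors are given by their components in the coordinate frame.
\<close>

definition partial_deriv :: "'n::finite \<Rightarrow> (real^'n \<Rightarrow> real) \<Rightarrow> real^'n \<Rightarrow> real" where
  "partial_deriv i f p = deriv (\<lambda>t. f (p + t *\<^sub>R axis i 1)) 0"

definition metric_inner :: "(real^'n \<Rightarrow> real^'n^'n) \<Rightarrow> real^'n \<Rightarrow> real^'n \<Rightarrow> real^'n \<Rightarrow> real" where
  "metric_inner g p u v = u \<bullet> (g p *v v)"

text \<open>
  \<open>christoffel g k i j\<close> is the Levi-Civita symbol \<open>\<Gamma>\<^sup>k\<^sub>i\<^sub>j\<close>, i.e. \<open>\<nabla>\<^sub>i \<partial>\<^sub>j = \<Gamma>\<^sup>k\<^sub>i\<^sub>j \<partial>\<^sub>k\<close>.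
\<close>

definition christoffel ::
    "(real^'n \<Rightarrow> real^'n^'n) \<Rightarrow> 'n \<Rightarrow> 'n \<Rightarrow> 'n \<Rightarrow> real^'n::finite \<Rightarrow> real" where
  "christoffel g k i j p =
     (1/2) * (\<Sum>l\<in>UNIV. matrix_inv (g p) $ k $ l *
       (partial_deriv i (\<lambda>q. g q $ j $ l) p
        + partial_deriv j (\<lambda>q. g q $ i $ l) p
        - partial_deriv l (\<lambda>q. g q $ i $ j) p))"

text \<open>
  Sign convention: \<open>R(X,Y)Z = \<nabla>\<^sub>X \<nabla>\<^sub>Y Z - \<nabla>\<^sub>Y \<nabla>\<^sub>X Z - \<nabla>\<^bsub>[X,Y]\<^esub> Z\<close>, and \<open>riemann_coeff g l i j k\<close> is
  the \<open>\<partial>\<^sub>l\<close>-component of \<open>R(\<partial>\<^sub>i, \<partial>\<^sub>j) \<partial>\<^sub>k\<close>.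
\<close>

definition riemann_coeff ::
    "(real^'n \<Rightarrow> real^'n^'n) \<Rightarrow> 'n \<Rightarrow> 'n \<Rightarrow> 'n \<Rightarrow> 'n \<Rightarrow> real^'n::finite \<Rightarrow> real" where
  "riemann_coeff g l i j k p =
     partial_deriv i (christoffel g l j k) p - partial_deriv j (christoffel g l i k) p
     + (\<Sum>m\<in>UNIV. christoffel g m j k p * christoffel g l i m p
                  - christoffel g m i k p * christoffel g l j m p)"

definition riemann_curvature ::
    "(real^'n \<Rightarrow> real^'n^'n) \<Rightarrow> real^'n::finite \<Rightarrow> real^'n \<Rightarrow> real^'n \<Rightarrow> real^'n \<Rightarrow> real^'n" where
  "riemann_curvature g p u v w =
     (\<chi> l. \<Sum>i\<in>UNIV. \<Sum>j\<in>UNIV. \<Sum>k\<in>UNIV. riemann_coeff g l i j k p * u $ i * v $ j * w $ k)"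

text \<open>
  The sectional curvature of the tangent plane at \<open>p\<close> spanned by \<open>u\<close> and \<open>v\<close>; meaningful
  only if \<open>u\<close> and \<open>v\<close> are linearly independent. In this convention round spheres have
  positive curvature.
\<close>

definition sectional_curvature ::
    "(real^'n \<Rightarrow> real^'n^'n) \<Rightarrow> real^'n::finite \<Rightarrow> real^'n \<Rightarrow> real^'n \<Rightarrow> real" where
  "sectional_curvature g p u v =
     metric_inner g p (riemann_curvature g p u v v) u /
     (metric_inner g p u u * metric_inner g p v v - (metric_inner g p u v)\<^sup>2)"

abbreviation psi1 :: "real \<Rightarrow> real" where
  "psi1 \<equiv> deriv Digamma"

abbreviation psi2 :: "real \<Rightarrow> real" where
  "psi2 \<equiv> deriv (deriv Digamma)"

text \<open>
  The Fisher--Rao metric of the beta distributions in the coordinates \<open>(\<alpha>, \<beta>) = (p $ 1, p $ 2)\<close>.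
  It is only meaningful on the open quadrant \<open>p $ 1 > 0\<close>, \<open>p $ 2 > 0\<close>.
\<close>

definition beta_fisher_metric :: "real^2 \<Rightarrow> real^2^2" where
  "beta_fisher_metric p =
     vector [vector [psi1 (p $ 1) - psi1 (p $ 1 + p $ 2), - psi1 (p $ 1 + p $ 2)],
             vector [- psi1 (p $ 1 + p $ 2), psi1 (p $ 2) - psi1 (p $ 1 + p $ 2)]]"

definition beta_d :: "real \<Rightarrow> real \<Rightarrow> real" where
  "beta_d \<alpha> \<beta> = psi1 \<alpha> * psi1 \<beta> - psi1 (\<alpha> + \<beta>) * (psi1 \<alpha> + psi1 \<beta>)"

end

theory Submission
  imports Defs
begin

text \<open>
  Since \<open>\<psi> = (ln \<Gamma>)'\<close>, the Fisher--Rao metric of the beta distributions is the Hessian of the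
  potential \<open>\<Phi>(x, y) = ln \<Gamma>(x) + ln \<Gamma>(y) - ln \<Gamma>(x + y)\<close>. For a Hessian metric
  the Levi-Civita symbols with all indices down are \<open>\<Phi>\<^sub>i\<^sub>j\<^sub>k / 2\<close>, totally symmetric in
  \<open>i\<close>, \<open>j\<close>, \<open>k\<close>, so the fourth derivatives of the potential cancel in the curvature:
  \<^item> \<open>\<langle>R(\<partial>\<^sub>1, \<partial>\<^sub>2) \<partial>\<^sub>2, \<partial>\<^sub>1\<rangle> = \<Sum>\<^sub>k\<^sub>,\<^sub>l g\<^sup>k\<^sup>l (\<Phi>\<^sub>1\<^sub>2\<^sub>k \<Phi>\<^sub>1\<^sub>2\<^sub>l - \<Phi>\<^sub>1\<^sub>1\<^sub>k \<Phi>\<^sub>2\<^sub>2\<^sub>l) / 4\<close>.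

  For the beta distributions the Hessian is \<open>diag(\<psi>'(x), \<psi>'(y))\<close> minus \<open>\<psi>'(x + y)\<close> times the all-ones matrix;
  its third derivatives involve only \<open>\<psi>''\<close> at \<open>x\<close>, \<open>y\<close> and \<open>x + y\<close>, and its determinant is
  \<open>d(x, y)\<close>. Evaluating the sum gives
  \<^item> \<open>(\<psi>'(x) \<psi>''(y) \<psi>''(x+y) + \<psi>'(y) \<psi>''(x) \<psi>''(x+y) - \<psi>'(x+y) \<psi>''(x) \<psi>''(y)) / (4 d(x, y))\<close>,

  and a further division by the determinant of the metric yields the curvature. As \<open>\<psi>''\<close> has no
  zero on the positive axis, \<open>\<psi>''(x) \<psi>''(y) \<psi>''(x+y)\<close> can be pulled out of the numerator.

  Nothing but the shape of the metric matters in this computation. It is therefore carried out in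
  \<open>sectional_curvature_metric\<close> with arbitrary smooth enough functions \<open>f\<close>, \<open>g\<close>, \<open>h\<close> in place of
  \<open>\<psi>'\<close> at \<open>x\<close>, \<open>y\<close> and \<open>x + y\<close>. That one component of the curvature operator determines the
  sectional curvature of every basis of the tangent plane is \<open>sectional_curvature_2\<close>.
\<close>

section \<open>Matrices, partial derivatives and curvature in dimension two\<close>

lemma matrix_inv_eqI:
  fixes A B :: "'a::semiring_1^'n^'n"
  assumes "A ** B = mat 1" and "B ** A = mat 1"
  shows "matrix_inv A = B"
proof -
  have inv: "A ** matrix_inv A = mat 1 \<and> matrix_inv A ** A = mat 1"
    unfolding matrix_inv_def by (rule someI[of _ B]) (simp add: assms)
  have "matrix_inv A = (B ** A) ** matrix_inv A"
    by (simp add: assms)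
  also have "\<dots> = B ** (A ** matrix_inv A)"
    by (rule matrix_mul_assoc[symmetric])
  also have "\<dots> = B"
    by (simp add: inv)
  finally show ?thesis .
qed

lemma matrix_inv_2:
  fixes a b c d e :: real
  assumes "a * d - b * c = e" and "e \<noteq> 0"
  shows "matrix_inv (vector [vector [a, b], vector [c, d]] :: real^2^2) =
    vector [vector [d / e, - b / e], vector [- c / e, a / e]]"
proof -
  have unit: "a * d / e - b * c / e = 1"
    using assms by (simp add: diff_divide_distrib[symmetric])
  define A B :: "real^2^2" where "A = vector [vector [a, b], vector [c, d]]"
    and "B = vector [vector [d / e, - b / e], vector [- c / e, a / e]]"
  have "A ** B = mat 1" "B ** A = mat 1"
    using unit unfolding A_def B_def
    by (simp_all add: vec_eq_iff matrix_matrix_mult_def forall_2 sum_2 mat_def)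
       (simp_all add: mult.commute)
  then show ?thesis
    unfolding A_def B_def by (rule matrix_inv_eqI)
qed

text \<open>
  The Christoffel symbols have a closed form only where the metric is nondegenerate, so all that is
  available for differentiating them at \<open>p\<close> is an equation that holds near \<open>p\<close>. This and the
  next lemma turn such an equation into a one-variable differentiation.
\<close>

lemma partial_deriv_1_eqI:
  assumes "\<forall>\<^sub>F q in nhds p. f q = h (q $ 1) (q $ 2)"
    and "((\<lambda>x. h x (p $ 2)) has_real_derivative c) (at (p $ 1))"
  shows "partial_deriv 1 f (p :: real^2) = c"
proof -
  let ?\<gamma> = "\<lambda>t::real. p + t *\<^sub>R axis 1 1"
  have "(?\<gamma> \<longlongrightarrow> p + 0 *\<^sub>R axis 1 1) (nhds 0)"
    by (intro tendsto_intros filterlim_ident)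
  then have "\<forall>\<^sub>F t in nhds 0. f (?\<gamma> t) = h (?\<gamma> t $ 1) (?\<gamma> t $ 2)"
    using assms(1) by (auto simp: filterlim_iff)
  then have "\<forall>\<^sub>F t in nhds 0. f (?\<gamma> t) = h (t + p $ 1) (p $ 2)"
    by (simp add: axis_def add.commute)
  moreover have "((\<lambda>t. h (t + p $ 1) (p $ 2)) has_real_derivative c) (at 0)"
    using assms(2) DERIV_shift[of "\<lambda>x. h x (p $ 2)" c 0 "p $ 1"] by simp
  ultimately show ?thesis
    unfolding partial_deriv_def
    by (intro DERIV_imp_deriv) (subst DERIV_cong_ev[OF refl _ refl])
qed

lemma partial_deriv_2_eqI:
  assumes "\<forall>\<^sub>F q in nhds p. f q = h (q $ 1) (q $ 2)"
    and "((\<lambda>y. h (p $ 1) y) has_real_derivative c) (at (p $ 2))"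
  shows "partial_deriv 2 f (p :: real^2) = c"
proof -
  let ?\<gamma> = "\<lambda>t::real. p + t *\<^sub>R axis 2 1"
  have "(?\<gamma> \<longlongrightarrow> p + 0 *\<^sub>R axis 2 1) (nhds 0)"
    by (intro tendsto_intros filterlim_ident)
  then have "\<forall>\<^sub>F t in nhds 0. f (?\<gamma> t) = h (?\<gamma> t $ 1) (?\<gamma> t $ 2)"
    using assms(1) by (auto simp: filterlim_iff)
  then have "\<forall>\<^sub>F t in nhds 0. f (?\<gamma> t) = h (p $ 1) (t + p $ 2)"
    by (simp add: axis_def add.commute)
  moreover have "((\<lambda>t. h (p $ 1) (t + p $ 2)) has_real_derivative c) (at 0)"
    using assms(2) DERIV_shift[of "\<lambda>y. h (p $ 1) y" c 0 "p $ 2"] by simp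
  ultimately show ?thesis
    unfolding partial_deriv_def
    by (intro DERIV_imp_deriv) (subst DERIV_cong_ev[OF refl _ refl])
qed

lemma independent_2_cross_nonzero:
  fixes u v :: "real^2"
  assumes "u \<noteq> v" and "independent {u, v}"
  shows "u $ 1 * v $ 2 - u $ 2 * v $ 1 \<noteq> 0"
proof
  assume cross: "u $ 1 * v $ 2 - u $ 2 * v $ 1 = 0"
  have trivial: "a = 0 \<and> b = 0" if "a *\<^sub>R u + b *\<^sub>R v = 0" for a b
  proof -
    have sum: "(\<Sum>w\<in>{u, v}. (if w = u then a else b) *\<^sub>R w) = 0"
      using that assms(1) by simp
    show ?thesis
      using independentD[OF assms(2) _ subset_refl sum, of u]
        independentD[OF assms(2) _ subset_refl sum, of v] assms(1) by simp
  qed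
  have "v $ 2 *\<^sub>R u + (- u $ 2) *\<^sub>R v = 0" and "v $ 1 *\<^sub>R u + (- u $ 1) *\<^sub>R v = 0"
    using cross by (simp_all add: vec_eq_iff forall_2 mult.commute)
  then have "u $ 2 = 0" and "u $ 1 = 0"
    using trivial by (metis neg_equal_0_iff_equal)+
  then have "u = 0"
    by (simp add: vec_eq_iff forall_2)
  then show False
    using assms(2) dependent_zero by auto
qed

text \<open>
  The Gram determinant of \<open>u\<close> and \<open>v\<close> with respect to \<open>g\<close> is the determinant of
  \<open>M\<^sup>T g M\<close>, where \<open>M\<close> has the columns \<open>u\<close> and \<open>v\<close>.
\<close>

lemma metric_inner_gram_2:
  fixes g :: "real^2 \<Rightarrow> real^2^2"
  assumes "g p $ 2 $ 1 = g p $ 1 $ 2"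
  shows "metric_inner g p u u * metric_inner g p v v - (metric_inner g p u v)\<^sup>2 =
    det (g p) * (u $ 1 * v $ 2 - u $ 2 * v $ 1)\<^sup>2"
  unfolding metric_inner_def
  by (simp add: inner_vec_def matrix_vector_mult_def sum_2 det_2 assms) algebra

text \<open>
  By antisymmetry in the first two arguments, \<open>R(u, v) = w R(\<partial>\<^sub>1, \<partial>\<^sub>2)\<close> for
  \<open>w = u\<^sub>1 v\<^sub>2 - u\<^sub>2 v\<^sub>1\<close>. The matrix \<open>R m k\<close> of \<open>\<langle>R(\<partial>\<^sub>1, \<partial>\<^sub>2) \<partial>\<^sub>k, \<partial>\<^sub>m\<rangle>\<close> is a
  multiple of the standard symplectic matrix as soon as it is skew, hence pairing it with \<open>u\<close> and
  \<open>v\<close> contributes a second factor \<open>w\<close>. The factor \<open>w\<^sup>2\<close> cancels against the Gram determinant.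
\<close>

lemma sectional_curvature_2:
  fixes g :: "real^2 \<Rightarrow> real^2^2" and p u v :: "real^2"
  defines "R \<equiv> \<lambda>m k. \<Sum>l\<in>UNIV. g p $ m $ l * riemann_coeff g l 1 2 k p"
  assumes sym: "g p $ 2 $ 1 = g p $ 1 $ 2"
    and skew: "R 1 1 = 0" "R 2 2 = 0" "R 2 1 = - R 1 2"
    and indep: "u \<noteq> v" "independent {u, v}"
  shows "sectional_curvature g p u v = R 1 2 / det (g p)"
proof -
  define w where "w = u $ 1 * v $ 2 - u $ 2 * v $ 1"
  have w: "w \<noteq> 0"
    unfolding w_def using indep by (rule independent_2_cross_nonzero)
  have diag: "riemann_coeff g l i i k p = 0" for l i k
    by (simp add: riemann_coeff_def)
  have swap: "riemann_coeff g l 2 1 k p = - riemann_coeff g l 1 2 k p" for l k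
    by (simp add: riemann_coeff_def sum_2)
  have "metric_inner g p (riemann_curvature g p u v v) u =
      w * (\<Sum>m\<in>UNIV. \<Sum>k\<in>UNIV. R m k * u $ m * v $ k)"
    unfolding metric_inner_def riemann_curvature_def R_def w_def
    by (simp add: inner_vec_def matrix_vector_mult_def sum_2 diag swap sym) algebra
  also have "\<dots> = R 1 2 * w\<^sup>2"
    using skew unfolding w_def by (simp add: sum_2 power2_eq_square algebra_simps)
  finally have num: "metric_inner g p (riemann_curvature g p u v v) u = R 1 2 * w\<^sup>2" .
  show ?thesis
    unfolding sectional_curvature_def num metric_inner_gram_2[of g p u v, OF sym, folded w_def]
    using w by simp
qed

section \<open>Hessian metrics of potentials \<open>F(x) + G(y) - H(x + y)\<close>\<close>

text \<open>
  The functions \<open>f\<close>, \<open>g\<close>, \<open>h\<close> are the second derivatives of \<open>F\<close>, \<open>G\<close>, \<open>H\<close>, so \<open>f'\<close>, \<open>g'\<close>, \<open>h'\<close>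
  determine its third derivatives. Of these, only \<open>h'\<close> has to be differentiable: \<open>R(\<partial>\<^sub>1, \<partial>\<^sub>2)\<close>
  involves \<open>\<partial>\<^sub>1 \<Gamma>\<^sup>k\<^sub>2\<^sub>j\<close> and \<open>\<partial>\<^sub>2 \<Gamma>\<^sup>k\<^sub>1\<^sub>j\<close>, hence just the mixed fourth derivatives of the potential,
  and these come from \<open>H(x + y)\<close> alone.
\<close>

locale separable_hessian_metric =
  fixes f f' g g' h h' h'' :: "real \<Rightarrow> real"
  assumes f: "x > 0 \<Longrightarrow> (f has_real_derivative f' x) (at x)"
    and g: "x > 0 \<Longrightarrow> (g has_real_derivative g' x) (at x)"
    and h: "x > 0 \<Longrightarrow> (h has_real_derivative h' x) (at x)"
    and h': "x > 0 \<Longrightarrow> (h' has_real_derivative h'' x) (at x)"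
begin

definition metric :: "real^2 \<Rightarrow> real^2^2" where
  "metric p =
     vector [vector [f (p $ 1) - h (p $ 1 + p $ 2), - h (p $ 1 + p $ 2)],
             vector [- h (p $ 1 + p $ 2), g (p $ 2) - h (p $ 1 + p $ 2)]]"

definition metric_det :: "real \<Rightarrow> real \<Rightarrow> real" where
  "metric_det x y = f x * g y - h (x + y) * (f x + g y)"

lemma det_metric: "det (metric p) = metric_det (p $ 1) (p $ 2)"
  by (simp add: metric_def metric_det_def det_2 algebra_simps)

lemmas derivs =
  f[THEN DERIV_chain2, THEN DERIV_cong]
  g[THEN DERIV_chain2, THEN DERIV_cong]
  h[THEN DERIV_chain2, THEN DERIV_cong]
  h'[THEN DERIV_chain2, THEN DERIV_cong]

lemma partial_deriv_metric:
  assumes "p $ 1 > 0" "p $ 2 > 0"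
  shows "partial_deriv 1 (\<lambda>q. metric q $ 1 $ 1) p = f' (p $ 1) - h' (p $ 1 + p $ 2)"
    and "partial_deriv 2 (\<lambda>q. metric q $ 1 $ 1) p = - h' (p $ 1 + p $ 2)"
    and "partial_deriv 1 (\<lambda>q. metric q $ 1 $ 2) p = - h' (p $ 1 + p $ 2)"
    and "partial_deriv 2 (\<lambda>q. metric q $ 1 $ 2) p = - h' (p $ 1 + p $ 2)"
    and "partial_deriv 1 (\<lambda>q. metric q $ 2 $ 1) p = - h' (p $ 1 + p $ 2)"
    and "partial_deriv 2 (\<lambda>q. metric q $ 2 $ 1) p = - h' (p $ 1 + p $ 2)"
    and "partial_deriv 1 (\<lambda>q. metric q $ 2 $ 2) p = - h' (p $ 1 + p $ 2)"
    and "partial_deriv 2 (\<lambda>q. metric q $ 2 $ 2) p = g' (p $ 2) - h' (p $ 1 + p $ 2)"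
  using assms unfolding metric_def vector_2
  by (auto intro!: partial_deriv_1_eqI[OF always_eventually] partial_deriv_2_eqI[OF always_eventually]
        derivative_eq_intros derivs)

lemma matrix_inv_metric:
  assumes "metric_det (p $ 1) (p $ 2) \<noteq> 0"
  defines "D \<equiv> metric_det (p $ 1) (p $ 2)"
  shows "matrix_inv (metric p) =
    vector [vector [(g (p $ 2) - h (p $ 1 + p $ 2)) / D, h (p $ 1 + p $ 2) / D],
            vector [h (p $ 1 + p $ 2) / D, (f (p $ 1) - h (p $ 1 + p $ 2)) / D]]"
proof -
  have "(f (p $ 1) - h (p $ 1 + p $ 2)) * (g (p $ 2) - h (p $ 1 + p $ 2))
      - (- h (p $ 1 + p $ 2)) * (- h (p $ 1 + p $ 2)) = D"
    by (simp add: D_def metric_det_def algebra_simps)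
  then show ?thesis
    using assms by (simp add: metric_def matrix_inv_2)
qed

text \<open>
  \<open>\<Gamma>k_ij\<close> is the symbol \<open>\<Gamma>\<^sup>k\<^sub>i\<^sub>j\<close>, the inverse metric applied to \<open>\<Phi>\<^sub>i\<^sub>j\<^sub>l / 2\<close>. Each one is
  kept as a single fraction over twice the determinant, so that all its derivatives and products are
  fractions over four times the squared determinant.
\<close>

definition \<Gamma>1_11 where
  "\<Gamma>1_11 x y = (g y * (f' x - h' (x + y)) - h (x + y) * f' x) / (2 * metric_det x y)"
definition \<Gamma>2_11 where
  "\<Gamma>2_11 x y = (h (x + y) * f' x - f x * h' (x + y)) / (2 * metric_det x y)"
definition \<Gamma>1_12 where
  "\<Gamma>1_12 x y = - (g y * h' (x + y)) / (2 * metric_det x y)"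
definition \<Gamma>2_12 where
  "\<Gamma>2_12 x y = - (f x * h' (x + y)) / (2 * metric_det x y)"
definition \<Gamma>1_22 where
  "\<Gamma>1_22 x y = (h (x + y) * g' y - g y * h' (x + y)) / (2 * metric_det x y)"
definition \<Gamma>2_22 where
  "\<Gamma>2_22 x y = (f x * (g' y - h' (x + y)) - h (x + y) * g' y) / (2 * metric_det x y)"

lemmas \<Gamma>_defs = \<Gamma>1_11_def \<Gamma>2_11_def \<Gamma>1_12_def \<Gamma>2_12_def \<Gamma>1_22_def \<Gamma>2_22_def

lemma christoffel_metric:
  assumes "p $ 1 > 0" "p $ 2 > 0" "metric_det (p $ 1) (p $ 2) \<noteq> 0"
  shows "christoffel metric 1 1 1 p = \<Gamma>1_11 (p $ 1) (p $ 2)"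
    and "christoffel metric 2 1 1 p = \<Gamma>2_11 (p $ 1) (p $ 2)"
    and "christoffel metric 1 1 2 p = \<Gamma>1_12 (p $ 1) (p $ 2)"
    and "christoffel metric 2 1 2 p = \<Gamma>2_12 (p $ 1) (p $ 2)"
    and "christoffel metric 1 2 1 p = \<Gamma>1_12 (p $ 1) (p $ 2)"
    and "christoffel metric 2 2 1 p = \<Gamma>2_12 (p $ 1) (p $ 2)"
    and "christoffel metric 1 2 2 p = \<Gamma>1_22 (p $ 1) (p $ 2)"
    and "christoffel metric 2 2 2 p = \<Gamma>2_22 (p $ 1) (p $ 2)"
  unfolding christoffel_def sum_2 partial_deriv_metric[OF assms(1,2)]
    matrix_inv_metric[OF assms(3)] \<Gamma>_defs vector_2
  using assms(3) by (simp_all add: field_simps)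

text \<open>
  The closed forms of the Christoffel symbols may be differentiated because they hold not just at
  a regular point but around it.
\<close>

lemma eventually_regular:
  fixes p :: "real^2"
  assumes "p $ 1 > 0" "p $ 2 > 0" "metric_det (p $ 1) (p $ 2) \<noteq> 0"
  shows "\<forall>\<^sub>F q in nhds p. q $ 1 > 0 \<and> q $ 2 > 0 \<and> metric_det (q $ 1) (q $ 2) \<noteq> 0"
proof -
  have comp: "((\<lambda>q. q $ i) \<longlongrightarrow> p $ i) (nhds p)" for i
    by (rule tendsto_vec_nth[OF filterlim_ident])
  have "((\<lambda>q. metric_det (q $ 1) (q $ 2)) \<longlongrightarrow> metric_det (p $ 1) (p $ 2)) (nhds p)"
    unfolding metric_det_def
    using assms
    by (intro tendsto_intros comp isCont_tendsto_compose[OF DERIV_isCont[OF f]]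
        isCont_tendsto_compose[OF DERIV_isCont[OF g]]
        isCont_tendsto_compose[OF DERIV_isCont[OF h]]) auto
  then have "\<forall>\<^sub>F q in nhds p. metric_det (q $ 1) (q $ 2) \<noteq> 0"
    using assms(3) by (rule tendsto_imp_eventually_ne)
  moreover have "\<forall>\<^sub>F q in nhds p. q $ i > 0" if "p $ i > 0" for i
    using order_tendstoD(1)[OF comp that] .
  ultimately show ?thesis
    using assms(1,2) by (auto intro!: eventually_conj)
qed

text \<open>
  The matrix of \<open>\<langle>R(\<partial>\<^sub>1, \<partial>\<^sub>2) \<partial>\<^sub>k, \<partial>\<^sub>m\<rangle>\<close> is \<open>\<kappa>\<close> times the skew matrix with entry \<open>1\<close> at
  \<open>(1, 2)\<close>; the four right-hand sides are the entries of the inverse metric times that matrix.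
\<close>

lemma riemann_coeff_metric:
  assumes pos: "p $ 1 > 0" "p $ 2 > 0" and D: "metric_det (p $ 1) (p $ 2) \<noteq> 0"
  defines "x \<equiv> p $ 1" and "y \<equiv> p $ 2"
  defines "\<kappa> \<equiv> (f x * g' y * h' (x + y) + g y * f' x * h' (x + y) - h (x + y) * f' x * g' y)
                / (4 * metric_det x y)"
  shows "riemann_coeff metric 1 1 2 1 p = - \<kappa> * h (x + y) / metric_det x y"
    and "riemann_coeff metric 1 1 2 2 p = \<kappa> * (g y - h (x + y)) / metric_det x y"
    and "riemann_coeff metric 2 1 2 1 p = - \<kappa> * (f x - h (x + y)) / metric_det x y"
    and "riemann_coeff metric 2 1 2 2 p = \<kappa> * h (x + y) / metric_det x y"
proof -
  let ?A = "f x" and ?B = "g y" and ?C = "h (x + y)"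
  let ?a = "f' x" and ?b = "g' y" and ?c = "h' (x + y)"
  let ?D = "metric_det x y"
  let ?D1 = "?a * ?B - ?c * (?A + ?B) - ?C * ?a" and ?D2 = "?A * ?b - ?c * (?A + ?B) - ?C * ?b"
  have xy: "x > 0" "y > 0" "x + y > 0" "?D \<noteq> 0"
    using assms by auto
  have quot: "((\<lambda>t. N t / (2 * G t)) has_real_derivative (n * G z - N z * d) / (2 * (G z)\<^sup>2)) (at z)"
    if "(N has_real_derivative n) (at z)" "(G has_real_derivative d) (at z)" "G z \<noteq> 0"
    for N G n d z
    using that by (auto intro!: derivative_eq_intros simp: field_simps power2_eq_square)
  have D1: "((\<lambda>t. metric_det t y) has_real_derivative ?D1) (at x)"
    unfolding metric_det_def using xy by (auto intro!: derivative_eq_intros derivs simp: algebra_simps)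
  have D2: "((\<lambda>t. metric_det x t) has_real_derivative ?D2) (at y)"
    unfolding metric_det_def using xy by (auto intro!: derivative_eq_intros derivs simp: algebra_simps)
  have ev: "\<forall>\<^sub>F q in nhds p. christoffel metric 1 1 1 q = \<Gamma>1_11 (q $ 1) (q $ 2)"
    "\<forall>\<^sub>F q in nhds p. christoffel metric 2 1 1 q = \<Gamma>2_11 (q $ 1) (q $ 2)"
    "\<forall>\<^sub>F q in nhds p. christoffel metric 1 1 2 q = \<Gamma>1_12 (q $ 1) (q $ 2)"
    "\<forall>\<^sub>F q in nhds p. christoffel metric 2 1 2 q = \<Gamma>2_12 (q $ 1) (q $ 2)"
    "\<forall>\<^sub>F q in nhds p. christoffel metric 1 2 1 q = \<Gamma>1_12 (q $ 1) (q $ 2)"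
    "\<forall>\<^sub>F q in nhds p. christoffel metric 2 2 1 q = \<Gamma>2_12 (q $ 1) (q $ 2)"
    "\<forall>\<^sub>F q in nhds p. christoffel metric 1 2 2 q = \<Gamma>1_22 (q $ 1) (q $ 2)"
    "\<forall>\<^sub>F q in nhds p. christoffel metric 2 2 2 q = \<Gamma>2_22 (q $ 1) (q $ 2)"
    by (rule eventually_mono[OF eventually_regular[OF pos D]]; simp add: christoffel_metric)+
  note deriv = derivative_eq_intros derivs
  have P1: "partial_deriv 1 (christoffel metric 1 2 1) p =
      ((- ?B * h'' (x + y)) * ?D - (- (?B * ?c)) * ?D1) / (2 * ?D\<^sup>2)"
    using xy by (intro partial_deriv_1_eqI[OF ev(5)], fold x_def y_def, unfold \<Gamma>_defs, intro quot D1)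
      (auto intro!: deriv)
  have P2: "partial_deriv 1 (christoffel metric 2 2 1) p =
      ((- ?a * ?c - ?A * h'' (x + y)) * ?D - (- (?A * ?c)) * ?D1) / (2 * ?D\<^sup>2)"
    using xy by (intro partial_deriv_1_eqI[OF ev(6)], fold x_def y_def, unfold \<Gamma>_defs, intro quot D1)
      (auto intro!: deriv)
  have P3: "partial_deriv 1 (christoffel metric 1 2 2) p =
      ((?c * ?b - ?B * h'' (x + y)) * ?D - (?C * ?b - ?B * ?c) * ?D1) / (2 * ?D\<^sup>2)"
    using xy by (intro partial_deriv_1_eqI[OF ev(7)], fold x_def y_def, unfold \<Gamma>_defs, intro quot D1)
      (auto intro!: deriv)
  have P4: "partial_deriv 1 (christoffel metric 2 2 2) p =
      ((?a * (?b - ?c) - ?A * h'' (x + y) - ?c * ?b) * ?D - (?A * (?b - ?c) - ?C * ?b) * ?D1) / (2 * ?D\<^sup>2)"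
    using xy by (intro partial_deriv_1_eqI[OF ev(8)], fold x_def y_def, unfold \<Gamma>_defs, intro quot D1)
      (auto intro!: deriv)
  have Q1: "partial_deriv 2 (christoffel metric 1 1 1) p =
      ((?b * (?a - ?c) - ?B * h'' (x + y) - ?c * ?a) * ?D - (?B * (?a - ?c) - ?C * ?a) * ?D2) / (2 * ?D\<^sup>2)"
    using xy by (intro partial_deriv_2_eqI[OF ev(1)], fold x_def y_def, unfold \<Gamma>_defs, intro quot D2)
      (auto intro!: deriv)
  have Q2: "partial_deriv 2 (christoffel metric 2 1 1) p =
      ((?c * ?a - ?A * h'' (x + y)) * ?D - (?C * ?a - ?A * ?c) * ?D2) / (2 * ?D\<^sup>2)"
    using xy by (intro partial_deriv_2_eqI[OF ev(2)], fold x_def y_def, unfold \<Gamma>_defs, intro quot D2)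
      (auto intro!: deriv)
  have Q3: "partial_deriv 2 (christoffel metric 1 1 2) p =
      ((- ?b * ?c - ?B * h'' (x + y)) * ?D - (- (?B * ?c)) * ?D2) / (2 * ?D\<^sup>2)"
    using xy by (intro partial_deriv_2_eqI[OF ev(3)], fold x_def y_def, unfold \<Gamma>_defs, intro quot D2)
      (auto intro!: deriv)
  have Q4: "partial_deriv 2 (christoffel metric 2 1 2) p =
      ((- ?A * h'' (x + y)) * ?D - (- (?A * ?c)) * ?D2) / (2 * ?D\<^sup>2)"
    using xy by (intro partial_deriv_2_eqI[OF ev(4)], fold x_def y_def, unfold \<Gamma>_defs, intro quot D2)
      (auto intro!: deriv)
  have D_eq: "?D = ?A * ?B - ?C * (?A + ?B)"
    by (rule metric_det_def)
  \<comment> \<open>Every summand becomes a fraction over \<open>4 D\<^sup>2\<close>. The numerators then agree as polynomials once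
      \<open>D\<close> is expressed by the values of \<open>f\<close>, \<open>g\<close> and \<open>h\<close>, and the terms with \<open>h''\<close> drop out.\<close>
  have over_4DD: "n / (2 * ?D\<^sup>2) = (2 * n) / (4 * ?D\<^sup>2)"
      "(m / (2 * ?D)) * (n / (2 * ?D)) = (m * n) / (4 * ?D\<^sup>2)"
      "n / (4 * ?D) * m / ?D = (n * m) / (4 * ?D\<^sup>2)"
      "- (n / (4 * ?D)) * m / ?D = (- n * m) / (4 * ?D\<^sup>2)" for m n
    by (simp_all add: power2_eq_square)
  note expand = riemann_coeff_def sum_2 christoffel_metric[OF pos D, folded x_def y_def]
    P1 P2 P3 P4 Q1 Q2 Q3 Q4 \<Gamma>_defs \<kappa>_def over_4DD
    add_divide_distrib[symmetric] diff_divide_distrib[symmetric]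
  show "riemann_coeff metric 1 1 2 1 p = - \<kappa> * h (x + y) / metric_det x y"
    unfolding expand by (rule arg_cong2[where f = "(/)", OF _ refl]) (use D_eq in algebra)
  show "riemann_coeff metric 1 1 2 2 p = \<kappa> * (g y - h (x + y)) / metric_det x y"
    unfolding expand by (rule arg_cong2[where f = "(/)", OF _ refl]) (use D_eq in algebra)
  show "riemann_coeff metric 2 1 2 1 p = - \<kappa> * (f x - h (x + y)) / metric_det x y"
    unfolding expand by (rule arg_cong2[where f = "(/)", OF _ refl]) (use D_eq in algebra)
  show "riemann_coeff metric 2 1 2 2 p = \<kappa> * h (x + y) / metric_det x y"
    unfolding expand by (rule arg_cong2[where f = "(/)", OF _ refl]) (use D_eq in algebra)
qed

theorem sectional_curvature_metric:
  fixes x y :: real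
  assumes "x > 0" "y > 0" "metric_det x y \<noteq> 0" and indep: "u \<noteq> v" "independent {u, v}"
  shows "sectional_curvature metric (vector [x, y]) u v =
    (f x * g' y * h' (x + y) + g y * f' x * h' (x + y) - h (x + y) * f' x * g' y)
      / (4 * (metric_det x y)\<^sup>2)"
proof -
  let ?p = "vector [x, y] :: real^2"
  define \<kappa> where "\<kappa> = (f x * g' y * h' (x + y) + g y * f' x * h' (x + y) - h (x + y) * f' x * g' y)
                / (4 * metric_det x y)"
  define R where "R m k = (\<Sum>l\<in>UNIV. metric ?p $ m $ l * riemann_coeff metric l 1 2 k ?p)" for m k
  have r: "riemann_coeff metric 1 1 2 1 ?p = - \<kappa> * h (x + y) / metric_det x y"
    "riemann_coeff metric 1 1 2 2 ?p = \<kappa> * (g y - h (x + y)) / metric_det x y"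
    "riemann_coeff metric 2 1 2 1 ?p = - \<kappa> * (f x - h (x + y)) / metric_det x y"
    "riemann_coeff metric 2 1 2 2 ?p = \<kappa> * h (x + y) / metric_det x y"
    using riemann_coeff_metric[of ?p] assms unfolding \<kappa>_def vector_2 by simp_all
  have R: "R 1 1 = 0" "R 2 2 = 0" "R 1 2 = \<kappa>" "R 2 1 = - \<kappa>"
    unfolding R_def sum_2 r metric_def vector_2 using assms(3)
    by (simp_all add: divide_simps) (simp_all add: metric_det_def algebra_simps)
  have "sectional_curvature metric ?p u v = R 1 2 / det (metric ?p)"
    unfolding R_def using R indep
    by (intro sectional_curvature_2) (simp_all add: R_def, simp_all add: metric_def)
  then show ?thesis
    by (simp add: R \<kappa>_def det_metric power2_eq_square)
qed

end

section \<open>The beta distributions\<close>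

lemma pos_not_nonpos_Int: "x > 0 \<Longrightarrow> x \<notin> \<int>\<^sub>\<le>\<^sub>0" for x :: real
  by (auto elim!: nonpos_Ints_cases)

text \<open>
  On the positive axis the iterated derivatives of the digamma function are the polygamma functions,
  which are given by convergent series and known to be differentiable.
\<close>

lemma has_real_derivative_higher_deriv_Digamma:
  fixes x :: real
  assumes "x > 0"
  shows "((deriv ^^ n) Digamma has_real_derivative (deriv ^^ Suc n) Digamma x) (at x)"
proof -
  have "(Polygamma n has_real_derivative Polygamma (Suc n) x) (at x)"
    using assms by (intro has_field_derivative_Polygamma pos_not_nonpos_Int)
  moreover have "Polygamma n z = (deriv ^^ n) Digamma z" if "z \<in> {0<..}" for z :: real
    using that by (simp add: higher_deriv_Polygamma pos_not_nonpos_Int)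
  ultimately have "((deriv ^^ n) Digamma has_real_derivative Polygamma (Suc n) x) (at x)"
    using assms has_field_derivative_transform_within_open[OF _ open_greaterThan] by blast
  then show ?thesis
    using DERIV_imp_deriv by fastforce
qed

lemma psi2_neg: "x > 0 \<Longrightarrow> psi2 x < 0"
  using higher_deriv_Polygamma[of x 2 0] Polygamma_real_even_neg[of x 2]
  by (simp add: pos_not_nonpos_Int numeral_2_eq_2)

interpretation beta: separable_hessian_metric
  psi1 psi2 psi1 psi2 psi1 psi2 "deriv psi2"
  using has_real_derivative_higher_deriv_Digamma[where n = 1]
    has_real_derivative_higher_deriv_Digamma[where n = 2]
  by unfold_locales (simp_all add: numeral_2_eq_2)

theorem proposition3:
  fixes \<alpha> \<beta> :: real and u v :: "real^2"
  assumes "\<alpha> > 0" and "\<beta> > 0"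
    and "u \<noteq> v" and "independent {u, v}"
  shows "sectional_curvature beta_fisher_metric (vector [\<alpha>, \<beta>]) u v =
    psi2 \<alpha> * psi2 \<beta> * psi2 (\<alpha> + \<beta>) / (4 * (beta_d \<alpha> \<beta>)\<^sup>2) *
    (psi1 \<alpha> / psi2 \<alpha> + psi1 \<beta> / psi2 \<beta> - psi1 (\<alpha> + \<beta>) / psi2 (\<alpha> + \<beta>))"
proof -
  have metric: "beta_fisher_metric = beta.metric"
    by (simp add: fun_eq_iff beta_fisher_metric_def beta.metric_def)
  have det: "beta.metric_det \<alpha> \<beta> = beta_d \<alpha> \<beta>"
    by (simp add: beta.metric_det_def beta_d_def)
  show ?thesis
  proof (cases "beta_d \<alpha> \<beta> = 0")
    \<comment> \<open>A vanishing determinant makes both denominators zero, and \<open>x / 0 = 0\<close>.\<close>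
    case True
    have "det (beta.metric (vector [\<alpha>, \<beta>])) = 0"
      by (simp add: beta.det_metric det True)
    then show ?thesis
      by (simp add: metric True sectional_curvature_def metric_inner_gram_2 beta.metric_def)
  next
    case False
    have "psi2 \<alpha> \<noteq> 0" "psi2 \<beta> \<noteq> 0" "psi2 (\<alpha> + \<beta>) \<noteq> 0"
      using psi2_neg[of \<alpha>] psi2_neg[of \<beta>] psi2_neg[of "\<alpha> + \<beta>"] assms by auto
    then have "psi2 \<alpha> * psi2 \<beta> * psi2 (\<alpha> + \<beta>) *
        (psi1 \<alpha> / psi2 \<alpha> + psi1 \<beta> / psi2 \<beta> - psi1 (\<alpha> + \<beta>) / psi2 (\<alpha> + \<beta>)) =
        psi1 \<alpha> * psi2 \<beta> * psi2 (\<alpha> + \<beta>) + psi1 \<beta> * psi2 \<alpha> * psi2 (\<alpha> + \<beta>)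
        - psi1 (\<alpha> + \<beta>) * psi2 \<alpha> * psi2 \<beta>"
      by (simp add: field_simps)
    then show ?thesis
      unfolding metric using beta.sectional_curvature_metric[of \<alpha> \<beta> u v] assms False
      by (simp add: det)
  qed
qed

end
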